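(* Let $R$ be either a finite field $\mathbb{F}_q$ or the ring $\mathbb{Z}_n$ of integers modulo $n$. Let $f:\{0,1,\dots,m_1-1\}\times\{0,1,\dots,m_2-1\}\to \mathcal{F}$ be a function with values in a finite set $\mathcal{F}$, and suppose that $f$ has a feasible expanded function $\tilde f(\tilde W_1,\tilde W_2)=\tilde W_1+\tilde W_2$ over $R$, with respect to confusable sets $\mathcal{S}_0,\mathcal{S}_1,\mathcal{S}_2,\dots$ of $R$ with randomizer $\gamma$. Let $z$ be uniformly distributed over $R$ and independent of $\gamma$, let the common randomness be $Z=(z,\gamma)$ (with distribution not depending on $(W_1,W_2)$), and define $$X_1=\gamma\times\tilde W_1+z,\qquad X_2=\gamma\times\tilde W_2-z,$$ where all operations are in $R$. Then this code, in which Alice and Bob each send one symbol of $R$ to Carol, is both correct and secure for computing $f$.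
   Context: Secure computation problem: Alice holds $W_1\in\{0,\dots,m_1-1\}$, Bob holds $W_2\in\{0,\dots,m_2-1\}$, and both hold a common random variable $Z$ whose distribution does not depend on $(W_1,W_2)$. Alice sends to Carol a codeword $X_1$ that is a function of $(W_1,Z)$, and Bob sends a codeword $X_2$ that is a function of $(W_2,Z)$. Correct: Carol can recover $f(W_1,W_2)$ from $(X_1,X_2)$ with no error, i.e. there is a decoding function $\phi$ with $\phi(X_1,X_2)=f(W_1,W_2)$ for every value of $(W_1,W_2)$ and every realization of $Z$. Secure: for every joint distribution of $(W_1,W_2)$ (independent of $Z$), $I(X_1,X_2;W_1,W_2\mid f(W_1,W_2))=0$. Equivalently, for any two input pairs $(w_1,w_2)$, $(w_1',w_2')$ with $f(w_1,w_2)=f(w_1',w_2')$, the distributions of $(X_1,X_2)$ (induced by $Z$) under the two input pairs are identical. Confusable sets and randomizer: sets $\mathcal{S}_0,\mathcal{S}_1,\mathcal{S}_2,\dots$ are called confusable sets of $R$ if they form a partition of $R$ and there exists a random variable $\gamma$, uniform over some set $\mathcal{S}^*\subset R$, such that for every $i$ and every $s\in\mathcal{S}_i$, the random variable $\gamma\times s$ is uniform over $\mathcal{S}_i$. Such a $\gamma$ is called the randomizer. Feasible expanded function: $\tilde f(\tilde W_1,\tilde W_2)=\tilde W_1+\tilde W_2$ (addition in $R$) is a feasible expanded function for $f$ if $\tilde W_1\in R$ is the image of $W_1$ under an injective map, $\tilde W_2\in R$ is the image of $W_2$ under an injective map, and the correspondence between $f(W_1,W_2)$ and the index $i$ of the confusable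 set $\mathcal{S}_i$ containing $\tilde W_1+\tilde W_2$ is invertible, i.e. for all input pairs, $f(w_1,w_2)=f(w_1',w_2')$ if and only if $\tilde w_1+\tilde w_2$ and $\tilde w_1'+\tilde w_2'$ lie in the same confusable set. *)

theory Defs
  imports "HOL-Algebra.IntRing" "HOL-Probability.Probability"
begin

section \<open>Codes for secure computation\<close>

text \<open>
  A code consists of the distribution \<^term>\<open>PZ\<close> of the common randomness together with the
  encoders \<^term>\<open>enc1\<close> and \<^term>\<open>enc2\<close>, mapping an input and a realization of the common
  randomness to a codeword. The inputs range over \<open>{..<m1}\<close> and \<open>{..<m2}\<close>.
\<close>

definition correct_code ::
  "nat \<Rightarrow> nat \<Rightarrow> (nat \<Rightarrow> nat \<Rightarrow> 'f) \<Rightarrow> 'z pmf \<Rightarrow> (nat \<Rightarrow> 'z \<Rightarrow> 'x) \<Rightarrow> (nat \<Rightarrow> 'z \<Rightarrow> 'y) \<Rightarrow> bool"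
  where
  "correct_code m1 m2 f PZ enc1 enc2 \<longleftrightarrow>
     (\<exists>dec. \<forall>w1<m1. \<forall>w2<m2. \<forall>z\<in>set_pmf PZ. dec (enc1 w1 z, enc2 w2 z) = f w1 w2)"

text \<open>
  A pmf as a probability space whose sample space is only the support, so that the image of the
  sample space under a random variable is the set of values attained with positive probability.
  On \<^term>\<open>measure_pmf p\<close> the sample space would be the whole type, and these images could be
  uncountable.
\<close>

definition pmf_space :: "'a pmf \<Rightarrow> 'a measure" where
  "pmf_space p = restrict_space (measure_pmf p) (set_pmf p)"

text \<open>
  The library's conditional mutual information, in bits, of discrete random variables on
  \<^term>\<open>M\<close>; it is the library's notation for \<open>\<I>(A ; B | C)\<close>, usable outside its locale.
\<close>

definition cond_mutual_info ::
  "'a measure \<Rightarrow> ('a \<Rightarrow> 'b) \<Rightarrow> ('a \<Rightarrow> 'c) \<Rightarrow> ('a \<Rightarrow> 'd) \<Rightarrow> real" where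
  "cond_mutual_info M A B C =
     prob_space.conditional_mutual_information M 2
       (count_space (A ` space M)) (count_space (B ` space M)) (count_space (C ` space M)) A B C"

text \<open>
  \<^term>\<open>PW\<close> ranges over all joint distributions of the inputs; the product
  \<^term>\<open>pair_pmf PW PZ\<close> makes the inputs independent of the common randomness.
\<close>

definition secure_code ::
  "nat \<Rightarrow> nat \<Rightarrow> (nat \<Rightarrow> nat \<Rightarrow> 'f) \<Rightarrow> 'z pmf \<Rightarrow> (nat \<Rightarrow> 'z \<Rightarrow> 'x) \<Rightarrow> (nat \<Rightarrow> 'z \<Rightarrow> 'y) \<Rightarrow> bool"
  where
  "secure_code m1 m2 f PZ enc1 enc2 \<longleftrightarrow>
     (\<forall>PW :: (nat \<times> nat) pmf. set_pmf PW \<subseteq> {..<m1} \<times> {..<m2} \<longrightarrow>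
        cond_mutual_info (pmf_space (pair_pmf PW PZ))
          (\<lambda>((w1, w2), z). (enc1 w1 z, enc2 w2 z))
          (\<lambda>((w1, w2), z). (w1, w2))
          (\<lambda>((w1, w2), z). f w1 w2) = 0)"


section \<open>Confusable sets and feasible expanded functions\<close>

text \<open>
  The integers modulo \<open>n\<close> are taken up to isomorphism, so that they share the type of the
  finite fields. The assumption \<^term>\<open>ring R\<close> is needed since \<open>\<simeq>\<close> alone does not constrain the
  zero of \<^term>\<open>R\<close>.
\<close>

definition finite_field_or_Zn :: "('a, 'b) ring_scheme \<Rightarrow> bool" where
  "finite_field_or_Zn R \<longleftrightarrow>
     (field R \<and> finite (carrier R)) \<or> (ring R \<and> (\<exists>n::nat. n \<ge> 1 \<and> R \<simeq> ZFact (int n)))"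

text \<open>
  The following notions are meant for finite \<^term>\<open>R\<close>: \<^term>\<open>pmf_of_set\<close> is the uniform
  distribution only on nonempty finite sets. The sets are \<^term>\<open>S i\<close> for \<open>i < k\<close>, and a random
  variable is represented by its distribution.
\<close>

definition randomizer ::
  "('a, 'b) ring_scheme \<Rightarrow> nat \<Rightarrow> (nat \<Rightarrow> 'a set) \<Rightarrow> 'a pmf \<Rightarrow> bool" where
  "randomizer R k S \<gamma> \<longleftrightarrow>
     (\<exists>T. T \<subseteq> carrier R \<and> T \<noteq> {} \<and> \<gamma> = pmf_of_set T) \<and>
     (\<forall>i<k. \<forall>s\<in>S i. map_pmf (\<lambda>g. g \<otimes>\<^bsub>R\<^esub> s) \<gamma> = pmf_of_set (S i))"

definition confusable_sets ::
  "('a, 'b) ring_scheme \<Rightarrow> nat \<Rightarrow> (nat \<Rightarrow> 'a set) \<Rightarrow> bool" where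
  "confusable_sets R k S \<longleftrightarrow>
     (\<Union>i<k. S i) = carrier R \<and> disjoint_family_on S {..<k} \<and> (\<forall>i<k. S i \<noteq> {}) \<and>
     (\<exists>\<gamma>. randomizer R k S \<gamma>)"

definition feasible_expanded_function ::
  "('a, 'b) ring_scheme \<Rightarrow> nat \<Rightarrow> (nat \<Rightarrow> 'a set) \<Rightarrow> nat \<Rightarrow> nat \<Rightarrow> (nat \<Rightarrow> nat \<Rightarrow> 'f) \<Rightarrow>
     (nat \<Rightarrow> 'a) \<Rightarrow> (nat \<Rightarrow> 'a) \<Rightarrow> bool" where
  "feasible_expanded_function R k S m1 m2 f e1 e2 \<longleftrightarrow>
     e1 \<in> {..<m1} \<rightarrow> carrier R \<and> inj_on e1 {..<m1} \<and>
     e2 \<in> {..<m2} \<rightarrow> carrier R \<and> inj_on e2 {..<m2} \<and>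
     (\<forall>w1<m1. \<forall>w2<m2. \<forall>w1'<m1. \<forall>w2'<m2.
        f w1 w2 = f w1' w2' \<longleftrightarrow>
        (\<exists>i<k. e1 w1 \<oplus>\<^bsub>R\<^esub> e2 w2 \<in> S i \<and> e1 w1' \<oplus>\<^bsub>R\<^esub> e2 w2' \<in> S i))"


section \<open>The code obtained from a feasible expanded function\<close>

definition common_randomness :: "('a, 'b) ring_scheme \<Rightarrow> 'a pmf \<Rightarrow> ('a \<times> 'a) pmf" where
  "common_randomness R \<gamma> = pair_pmf (pmf_of_set (carrier R)) \<gamma>"

definition alice :: "('a, 'b) ring_scheme \<Rightarrow> (nat \<Rightarrow> 'a) \<Rightarrow> nat \<Rightarrow> 'a \<times> 'a \<Rightarrow> 'a" where
  "alice R e1 w1 = (\<lambda>(z, g). (g \<otimes>\<^bsub>R\<^esub> e1 w1) \<oplus>\<^bsub>R\<^esub> z)"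

definition bob :: "('a, 'b) ring_scheme \<Rightarrow> (nat \<Rightarrow> 'a) \<Rightarrow> nat \<Rightarrow> 'a \<times> 'a \<Rightarrow> 'a" where
  "bob R e2 w2 = (\<lambda>(z, g). (g \<otimes>\<^bsub>R\<^esub> e2 w2) \<ominus>\<^bsub>R\<^esub> z)"

end

theory Submission
  imports Defs
begin

text \<open>
  The sum of the two codewords is \<open>\<gamma> s\<close>, where \<open>s\<close> is the sum of the expanded inputs; it lies in the
  same confusable set as \<open>s\<close>, which determines the value of \<open>f\<close>. Given \<open>\<gamma>\<close>, the first codeword is
  uniform on \<open>R\<close>, so that the pair of codewords is distributed as \<open>(u, t - u)\<close> with \<open>u\<close> uniform on \<open>R\<close>
  and \<open>t\<close> independent of \<open>u\<close> and uniform on that confusable set. This law depends on the inputs only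
  through the value of \<open>f\<close>.
\<close>

section \<open>Conditional mutual information on finite probability spaces\<close>

lemma space_pmf_space [simp]: "space (pmf_space p) = set_pmf p"
  by (simp add: pmf_space_def space_restrict_space)

lemma sets_pmf_space [simp]: "sets (pmf_space p) = Pow (set_pmf p)"
  by (auto simp: pmf_space_def sets_restrict_space image_iff)

lemma measure_pmf_space: "A \<subseteq> set_pmf p \<Longrightarrow> measure (pmf_space p) A = measure (measure_pmf p) A"
  by (simp add: pmf_space_def measure_restrict_space)

lemma prob_space_pmf_space: "prob_space (pmf_space p)"
  unfolding pmf_space_def
  by (intro prob_space_restrict_space)
     (auto simp: emeasure_pmf)

text \<open>Supplies the discrete densities that the formula for conditional mutual information asks
  for. Every subset of the support is measurable, so with finite support any function is
  simple.\<close>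

lemma simple_distributed_pmf_space:
  assumes "finite (set_pmf p)"
  shows "simple_distributed (pmf_space p) X (pmf (map_pmf X p))"
proof -
  interpret prob_space "pmf_space p"
    by (rule prob_space_pmf_space)
  have "simple_function (pmf_space p) X"
    using assms by (auto simp: simple_function_def)
  then show ?thesis
  proof (rule simple_distributedI)
    fix x
    have "pmf (map_pmf X p) x = measure (measure_pmf p) (X -` {x} \<inter> set_pmf p)"
      by (simp add: pmf_map measure_Int_set_pmf)
    then show "pmf (map_pmf X p) x = measure (pmf_space p) (X -` {x} \<inter> space (pmf_space p))"
      by (simp add: measure_pmf_space)
  qed simp
qed

text \<open>The assumption \<open>indep\<close> is conditional independence of \<open>X\<close> and
  \<open>Y\<close> given \<open>Z\<close>, in product form and only at attained values. It makes the
  argument of every logarithm in the defining sum equal to 1.\<close>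

lemma cond_mutual_info_pmf_space_eq_0:
  assumes fin: "finite (set_pmf p)"
    and indep: "\<And>\<omega>. \<omega> \<in> set_pmf p \<Longrightarrow>
      pmf (map_pmf (\<lambda>\<omega>. (X \<omega>, Y \<omega>, Z \<omega>)) p) (X \<omega>, Y \<omega>, Z \<omega>) * pmf (map_pmf Z p) (Z \<omega>) =
      pmf (map_pmf (\<lambda>\<omega>. (X \<omega>, Z \<omega>)) p) (X \<omega>, Z \<omega>) *
      pmf (map_pmf (\<lambda>\<omega>. (Y \<omega>, Z \<omega>)) p) (Y \<omega>, Z \<omega>)"
  shows "cond_mutual_info (pmf_space p) X Y Z = 0"
proof -
  interpret information_space "pmf_space p" 2
    by (intro information_space.intro prob_space_pmf_space) (unfold_locales, simp)
  have posXZ: "pmf (map_pmf (\<lambda>\<omega>. (X \<omega>, Z \<omega>)) p) (X \<omega>, Z \<omega>) > 0"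
    and posYZ: "pmf (map_pmf (\<lambda>\<omega>. (Y \<omega>, Z \<omega>)) p) (Y \<omega>, Z \<omega>) > 0"
    if "\<omega> \<in> set_pmf p" for \<omega>
    using that by (auto intro!: pmf_positive)
  have ratio: "pmf (map_pmf (\<lambda>\<omega>. (X \<omega>, Y \<omega>, Z \<omega>)) p) (X \<omega>, Y \<omega>, Z \<omega>) /
      (pmf (map_pmf (\<lambda>\<omega>. (X \<omega>, Z \<omega>)) p) (X \<omega>, Z \<omega>) *
       (pmf (map_pmf (\<lambda>\<omega>. (Y \<omega>, Z \<omega>)) p) (Y \<omega>, Z \<omega>) / pmf (map_pmf Z p) (Z \<omega>))) = 1"
    if "\<omega> \<in> set_pmf p" for \<omega>
    using indep[OF that] posXZ[OF that] posYZ[OF that] by simp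
  show ?thesis
    unfolding cond_mutual_info_def
    \<comment> \<open>The sum runs over attained triples, so \<open>ratio\<close> applies to each
      summand; the deleted simp rule would break up the nested quotient that \<open>ratio\<close>
      matches.\<close>
    by (subst conditional_mutual_information_eq[OF simple_distributed_pmf_space
          simple_distributed_pmf_space simple_distributed_pmf_space simple_distributed_pmf_space])
       (auto simp: fin ratio simp del: times_divide_eq_right intro!: sum.neutral)
qed

section \<open>Criteria for correctness and security\<close>

text \<open>The second component records which \<open>c\<close> was drawn from \<open>Q\<close>, so
  in the average over \<open>Q\<close> only that draw contributes.\<close>

lemma pmf_bind_map_Pair:
  "pmf (bind_pmf Q (\<lambda>c. map_pmf (\<lambda>x. (x, c)) (L c))) (x, c) = pmf Q c * pmf (L c) x"
proof -
  have "pmf (map_pmf (\<lambda>x. (x, d)) (L d)) (x, c) = pmf (L c) x * indicator {c} d" for d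
    by (cases "d = c") (auto simp: pmf_map_inj'[of "\<lambda>x. (x, c)"] inj_def pmf_eq_0_set_pmf)
  moreover have "(\<integral>d. pmf (L c) x * indicator {c} d \<partial>measure_pmf Q) = pmf (L c) x * pmf Q c"
    by (simp add: pmf.rep_eq)
  ultimately show ?thesis
    by (simp add: pmf_bind)
qed

text \<open>If the law of the codewords given the inputs \<open>w\<close> is some \<open>L c\<close>
  with \<open>c = F w\<close>, then P(x,w,c) = P(w) L_c(x), P(x,c) = P(c) L_c(x) and P(w,c) = P(w).
  This is conditional independence given the function value.\<close>

lemma secure_code_if_distributions_agree:
  fixes PZ :: "'z pmf"
  assumes fin: "finite (set_pmf PZ)"
    and agree: "\<And>w1 w2 w1' w2'. w1 < m1 \<Longrightarrow> w2 < m2 \<Longrightarrow> w1' < m1 \<Longrightarrow> w2' < m2 \<Longrightarrow>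
      f w1 w2 = f w1' w2' \<Longrightarrow>
      map_pmf (\<lambda>z. (enc1 w1 z, enc2 w2 z)) PZ = map_pmf (\<lambda>z. (enc1 w1' z, enc2 w2' z)) PZ"
  shows "secure_code m1 m2 f PZ enc1 enc2"
  unfolding secure_code_def
proof (intro allI impI)
  fix PW :: "(nat \<times> nat) pmf"
  assume supp: "set_pmf PW \<subseteq> {..<m1} \<times> {..<m2}"
  define X where "X = (\<lambda>((w1, w2), z). (enc1 w1 z, enc2 w2 z))"
  define F where "F = (\<lambda>(w1, w2). f w1 w2)"
  define K where "K w = map_pmf (\<lambda>z. X (w, z)) PZ" for w
  \<comment> \<open>The law is read off from an arbitrary representative of the fiber of
    \<open>c\<close>; for \<open>c\<close> outside the image of the support \<open>L c\<close> is
    junk, but such \<open>c\<close> have probability zero.\<close>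
  define L where "L c = K (SOME w. w \<in> set_pmf PW \<and> F w = c)" for c
  define P where "P = pair_pmf PW PZ"
  have KL: "K w = L (F w)" if "w \<in> set_pmf PW" for w
  proof -
    define v where "v = (SOME v. v \<in> set_pmf PW \<and> F v = F w)"
    have "v \<in> set_pmf PW \<and> F v = F w"
      unfolding v_def by (rule someI[of _ w]) (simp add: that)
    then have "K v = K w"
      using that supp by (auto simp: K_def X_def F_def split: prod.splits intro!: agree)
    then show ?thesis
      by (simp add: L_def v_def)
  qed
  have P: "P = bind_pmf PW (\<lambda>w. map_pmf (Pair w) PZ)"
    by (simp add: P_def pair_pmf_def map_pmf_def)
  have XY: "map_pmf (\<lambda>\<omega>. (X \<omega>, fst \<omega>)) P = bind_pmf PW (\<lambda>w. map_pmf (\<lambda>x. (x, w)) (K w))"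
    by (simp add: P K_def map_bind_pmf pmf.map_comp o_def)
  have "map_pmf (\<lambda>\<omega>. (X \<omega>, F (fst \<omega>))) P = bind_pmf PW (\<lambda>w. map_pmf (\<lambda>x. (x, F w)) (K w))"
    by (simp add: P K_def map_bind_pmf pmf.map_comp o_def)
  also have "\<dots> = bind_pmf (map_pmf F PW) (\<lambda>c. map_pmf (\<lambda>x. (x, c)) (L c))"
    by (auto simp: bind_map_pmf KL intro!: bind_pmf_cong)
  finally have XZ: "map_pmf (\<lambda>\<omega>. (X \<omega>, F (fst \<omega>))) P = \<dots>" .
  have W: "map_pmf fst P = PW"
    by (simp add: P_def map_fst_pair_pmf)
  have "cond_mutual_info (pmf_space P) X fst (\<lambda>\<omega>. F (fst \<omega>)) = 0"
  proof (rule cond_mutual_info_pmf_space_eq_0)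
    have "finite (set_pmf PW)"
      using supp by (rule finite_subset) simp
    with fin show "finite (set_pmf P)"
      by (simp add: P_def)
    fix \<omega> assume "\<omega> \<in> set_pmf P"
    then have w: "fst \<omega> \<in> set_pmf PW"
      by (auto simp: P_def)
    \<comment> \<open>Appending \<open>F w\<close> to a tuple that contains \<open>w\<close> is
      injective, so it leaves point probabilities unchanged.\<close>
    have "pmf (map_pmf (\<lambda>\<omega>. (X \<omega>, fst \<omega>, F (fst \<omega>))) P) (X \<omega>, fst \<omega>, F (fst \<omega>)) =
        pmf (map_pmf (\<lambda>(x, w). (x, w, F w)) (map_pmf (\<lambda>\<omega>. (X \<omega>, fst \<omega>)) P))
          ((\<lambda>(x, w). (x, w, F w)) (X \<omega>, fst \<omega>))"
      by (simp add: pmf.map_comp o_def)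
    also have "\<dots> = pmf (map_pmf (\<lambda>\<omega>. (X \<omega>, fst \<omega>)) P) (X \<omega>, fst \<omega>)"
      by (rule pmf_map_inj') (auto simp: inj_def)
    also have "\<dots> = pmf PW (fst \<omega>) * pmf (K (fst \<omega>)) (X \<omega>)"
      by (simp add: XY pmf_bind_map_Pair)
    finally have XYZ: "pmf (map_pmf (\<lambda>\<omega>. (X \<omega>, fst \<omega>, F (fst \<omega>))) P) (X \<omega>, fst \<omega>, F (fst \<omega>)) = \<dots>" .
    have "pmf (map_pmf (\<lambda>\<omega>. (fst \<omega>, F (fst \<omega>))) P) (fst \<omega>, F (fst \<omega>)) =
        pmf (map_pmf (\<lambda>w. (w, F w)) (map_pmf fst P)) ((\<lambda>w. (w, F w)) (fst \<omega>))"
      by (simp only: pmf.map_comp o_def)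
    also have "\<dots> = pmf PW (fst \<omega>)"
      unfolding W by (rule pmf_map_inj') (auto simp: inj_def)
    finally have YZ: "pmf (map_pmf (\<lambda>\<omega>. (fst \<omega>, F (fst \<omega>))) P) (fst \<omega>, F (fst \<omega>)) = \<dots>" .
    have Z: "map_pmf (\<lambda>\<omega>. F (fst \<omega>)) P = map_pmf F PW"
      by (simp add: W[symmetric] pmf.map_comp o_def)
    show "pmf (map_pmf (\<lambda>\<omega>. (X \<omega>, fst \<omega>, F (fst \<omega>))) P) (X \<omega>, fst \<omega>, F (fst \<omega>)) *
          pmf (map_pmf (\<lambda>\<omega>. F (fst \<omega>)) P) (F (fst \<omega>)) =
        pmf (map_pmf (\<lambda>\<omega>. (X \<omega>, F (fst \<omega>))) P) (X \<omega>, F (fst \<omega>)) *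
          pmf (map_pmf (\<lambda>\<omega>. (fst \<omega>, F (fst \<omega>))) P) (fst \<omega>, F (fst \<omega>))"
      unfolding XYZ YZ Z XZ pmf_bind_map_Pair by (simp add: KL[OF w])
  qed
  moreover have "(\<lambda>((w1, w2), z). (w1, w2)) = (fst :: (nat \<times> nat) \<times> 'z \<Rightarrow> _)"
    by auto
  moreover have "(\<lambda>((w1, w2), z :: 'z). f w1 w2) = (\<lambda>\<omega>. F (fst \<omega>))"
    by (auto simp: F_def)
  ultimately show "cond_mutual_info (pmf_space (pair_pmf PW PZ))
      (\<lambda>((w1, w2), z). (enc1 w1 z, enc2 w2 z)) (\<lambda>((w1, w2), z). (w1, w2))
      (\<lambda>((w1, w2), z). f w1 w2) = 0"
    by (simp only: P_def X_def)
qed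

text \<open>A decoder exists as soon as each attainable pair of codewords belongs to a single value
  of \<open>f\<close>. The realizations \<open>z\<close> and \<open>z'\<close> may differ, since
  Carol does not see the common randomness.\<close>

lemma correct_codeI:
  assumes "\<And>w1 w2 w1' w2' z z'. w1 < m1 \<Longrightarrow> w2 < m2 \<Longrightarrow> w1' < m1 \<Longrightarrow> w2' < m2 \<Longrightarrow>
      z \<in> set_pmf PZ \<Longrightarrow> z' \<in> set_pmf PZ \<Longrightarrow>
      enc1 w1 z = enc1 w1' z' \<Longrightarrow> enc2 w2 z = enc2 w2' z' \<Longrightarrow> f w1 w2 = f w1' w2'"
  shows "correct_code m1 m2 f PZ enc1 enc2"
proof -
  define Q where "Q p c \<longleftrightarrow> (\<exists>w1<m1. \<exists>w2<m2. \<exists>z\<in>set_pmf PZ.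
    p = (enc1 w1 z, enc2 w2 z) \<and> c = f w1 w2)" for p c
  have "(SOME c. Q (enc1 w1 z, enc2 w2 z) c) = f w1 w2"
    if "w1 < m1" "w2 < m2" "z \<in> set_pmf PZ" for w1 w2 z
  proof (rule some_equality)
    show "Q (enc1 w1 z, enc2 w2 z) (f w1 w2)"
      using that unfolding Q_def by blast
    fix c
    assume "Q (enc1 w1 z, enc2 w2 z) c"
    then obtain w1' w2' z' where "w1' < m1" "w2' < m2" "z' \<in> set_pmf PZ" "c = f w1' w2'"
      "enc1 w1' z' = enc1 w1 z" "enc2 w2' z' = enc2 w2 z"
      unfolding Q_def by auto
    then show "c = f w1 w2"
      using assms[of w1' w2' w1 w2 z' z] that by simp
  qed
  then show ?thesis
    unfolding correct_code_def by (intro exI[of _ "\<lambda>p. SOME c. Q p c"]) simp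
qed

section \<open>The code over a finite ring\<close>

text \<open>Each residue class has a representative in \<open>{0..<int n}\<close>. The bound on
  \<open>n\<close> excludes \<open>ZFact 0\<close>, a copy of the infinite ring of integers.\<close>

lemma finite_carrier_ZFact:
  assumes "n \<ge> (1::nat)"
  shows "finite (carrier (ZFact (int n)))"
proof -
  have "carrier (ZFact (int n)) = range (ZMod (int n))"
    by (auto simp: ZFact_defs A_RCOSETS_defs ZMod_def a_r_coset_def)
  also have "\<dots> \<subseteq> ZMod (int n) ` {0..<int n}"
  proof (rule image_subsetI)
    fix a
    have "a mod int n \<in> {0..<int n}"
      using assms by simp
    then show "ZMod (int n) a \<in> ZMod (int n) ` {0..<int n}"
      using ZMod_mod[of "int n" a] by (rule rev_image_eqI)
  qed
  finally show ?thesis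
    by (rule finite_subset) simp
qed

lemma finite_field_or_Zn_imp_finite_ring:
  assumes "finite_field_or_Zn R"
  shows "ring R" and "finite (carrier R)"
proof -
  show "ring R"
    using assms unfolding finite_field_or_Zn_def
    by (auto intro: cring.axioms domain.axioms field.axioms)
  have "finite (carrier R)" if "R \<simeq> ZFact (int n)" "n \<ge> 1" for n
    using that finite_carrier_ZFact[of n] bij_betw_finite
    unfolding is_ring_iso_def ring_iso_def by blast
  then show "finite (carrier R)"
    using assms unfolding finite_field_or_Zn_def by blast
qed

text \<open>The one-time pad: translation by \<open>c\<close> permutes the carrier, with translation
  by \<open>\<ominus> c\<close> as its inverse.\<close>

lemma (in ring) map_pmf_add_uniform:
  assumes "finite (carrier R)" "c \<in> carrier R"
  shows "map_pmf (\<lambda>z. c \<oplus> z) (pmf_of_set (carrier R)) = pmf_of_set (carrier R)"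
proof (rule map_pmf_of_set_bij_betw)
  show "bij_betw (\<lambda>z. c \<oplus> z) (carrier R) (carrier R)"
    using assms(2) by (intro bij_betw_byWitness[where f' = "\<lambda>z. \<ominus> c \<oplus> z"])
      (auto simp: a_assoc[symmetric] l_neg r_neg)
qed (use assms in auto)

text \<open>Substitute \<open>u = g \<otimes> a \<oplus> z\<close>. For each fixed \<open>g\<close>
  this is uniform, hence independent of \<open>g\<close>, and the second codeword becomes
  \<open>g \<otimes> (a \<oplus> b) \<ominus> u\<close>. Thus \<open>a\<close> and \<open>b\<close>
  enter the law only through their sum.\<close>

lemma (in ring) code_distribution:
  assumes fin: "finite (carrier R)"
    and \<gamma>: "set_pmf \<gamma> \<subseteq> carrier R"
    and a: "a \<in> carrier R" and b: "b \<in> carrier R"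
  shows "map_pmf (\<lambda>(z, g). (g \<otimes> a \<oplus> z, g \<otimes> b \<ominus> z)) (common_randomness R \<gamma>) =
    map_pmf (\<lambda>(t, u). (u, t \<ominus> u))
      (pair_pmf (map_pmf (\<lambda>g. g \<otimes> (a \<oplus> b)) \<gamma>) (pmf_of_set (carrier R)))"
proof -
  let ?U = "pmf_of_set (carrier R)"
  have U: "set_pmf ?U = carrier R"
    using fin by (intro set_pmf_of_set) auto
  have "map_pmf (\<lambda>z. (g \<otimes> a \<oplus> z, g \<otimes> b \<ominus> z)) ?U =
      map_pmf (\<lambda>u. (u, g \<otimes> (a \<oplus> b) \<ominus> u)) ?U" if g: "g \<in> set_pmf \<gamma>" for g
  proof -
    have g: "g \<in> carrier R"
      using g \<gamma> by blast
    have "g \<otimes> b \<ominus> z = g \<otimes> (a \<oplus> b) \<ominus> (g \<otimes> a \<oplus> z)" if "z \<in> carrier R" for z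
      using that g a b by algebra
    then have "map_pmf (\<lambda>z. (g \<otimes> a \<oplus> z, g \<otimes> b \<ominus> z)) ?U =
        map_pmf (\<lambda>u. (u, g \<otimes> (a \<oplus> b) \<ominus> u)) (map_pmf (\<lambda>z. g \<otimes> a \<oplus> z) ?U)"
      by (auto simp: pmf.map_comp U intro!: map_pmf_cong)
    then show ?thesis
      using g a by (simp add: map_pmf_add_uniform[OF fin])
  qed
  then have "bind_pmf \<gamma> (\<lambda>g. map_pmf (\<lambda>z. (g \<otimes> a \<oplus> z, g \<otimes> b \<ominus> z)) ?U) =
      bind_pmf \<gamma> (\<lambda>g. map_pmf (\<lambda>u. (u, g \<otimes> (a \<oplus> b) \<ominus> u)) ?U)"
    by (intro bind_pmf_cong) auto
  \<comment> \<open>The order of the two draws is exchanged so that \<open>g\<close> is fixed before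
    \<open>z\<close> is drawn.\<close>
  moreover have "pair_pmf ?U \<gamma> = bind_pmf \<gamma> (\<lambda>g. map_pmf (\<lambda>z. (z, g)) ?U)"
    unfolding pair_pmf_def map_pmf_def by (rule bind_commute_pmf)
  moreover have "pair_pmf (map_pmf (\<lambda>g. g \<otimes> (a \<oplus> b)) \<gamma>) ?U =
      bind_pmf \<gamma> (\<lambda>g. map_pmf (Pair (g \<otimes> (a \<oplus> b))) ?U)"
    unfolding pair_pmf_def map_pmf_def bind_assoc_pmf bind_return_pmf ..
  ultimately show ?thesis
    by (simp add: common_randomness_def map_bind_pmf pmf.map_comp o_def)
qed

theorem theorem1:
  fixes R :: "('a, 'b) ring_scheme"
    and m1 m2 k :: nat
    and F :: "'f set"
    and f :: "nat \<Rightarrow> nat \<Rightarrow> 'f"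
    and S :: "nat \<Rightarrow> 'a set"
    and \<gamma> :: "'a pmf"
    and e1 e2 :: "nat \<Rightarrow> 'a"
  assumes "finite_field_or_Zn R"
    and "finite F"
    and "\<forall>w1<m1. \<forall>w2<m2. f w1 w2 \<in> F"
    and "confusable_sets R k S"
    and "randomizer R k S \<gamma>"
    and "feasible_expanded_function R k S m1 m2 f e1 e2"
  shows "(\<forall>w1<m1. \<forall>zg\<in>set_pmf (common_randomness R \<gamma>). alice R e1 w1 zg \<in> carrier R) \<and>
         (\<forall>w2<m2. \<forall>zg\<in>set_pmf (common_randomness R \<gamma>). bob R e2 w2 zg \<in> carrier R) \<and>
         correct_code m1 m2 f (common_randomness R \<gamma>) (alice R e1) (bob R e2) \<and>
         secure_code m1 m2 f (common_randomness R \<gamma>) (alice R e1) (bob R e2)"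
proof -
  interpret ring R
    using assms(1) by (rule finite_field_or_Zn_imp_finite_ring)
  have fin: "finite (carrier R)"
    using assms(1) by (rule finite_field_or_Zn_imp_finite_ring)
  have S_sub: "S i \<subseteq> carrier R" if "i < k" for i
    using assms(4) that unfolding confusable_sets_def by blast
  have finS: "finite (S i)" and S_ne: "S i \<noteq> {}" if "i < k" for i
    using assms(4) S_sub[OF that] fin that finite_subset unfolding confusable_sets_def by auto
  obtain T where T: "T \<subseteq> carrier R" "T \<noteq> {}" "\<gamma> = pmf_of_set T"
    using assms(5) unfolding randomizer_def by blast
  have \<gamma>: "set_pmf \<gamma> \<subseteq> carrier R" and \<gamma>_fin: "finite (set_pmf \<gamma>)"
    using T fin finite_subset[of T] by auto
  have S_law: "map_pmf (\<lambda>g. g \<otimes>\<^bsub>R\<^esub> s) \<gamma> = pmf_of_set (S i)" if "i < k" "s \<in> S i" for i s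
    using assms(5) that unfolding randomizer_def by blast
  \<comment> \<open>Compares supports in \<open>S_law\<close>: each value attained by the product
    lies in the support of the uniform distribution on \<open>S i\<close>, which is
    \<open>S i\<close>.\<close>
  have S_closed: "g \<otimes>\<^bsub>R\<^esub> s \<in> S i" if "i < k" "s \<in> S i" "g \<in> set_pmf \<gamma>" for i s g
  proof -
    have "g \<otimes>\<^bsub>R\<^esub> s \<in> set_pmf (map_pmf (\<lambda>g. g \<otimes>\<^bsub>R\<^esub> s) \<gamma>)"
      using that by simp
    then show ?thesis
      using that by (simp add: S_law finS S_ne del: set_map_pmf)
  qed
  have e1: "e1 w \<in> carrier R" if "w < m1" for w
    using assms(6) that unfolding feasible_expanded_function_def by auto
  have e2: "e2 w \<in> carrier R" if "w < m2" for w
    using assms(6) that unfolding feasible_expanded_function_def by auto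
  have f_iff: "f w1 w2 = f w1' w2' \<longleftrightarrow>
      (\<exists>i<k. e1 w1 \<oplus>\<^bsub>R\<^esub> e2 w2 \<in> S i \<and> e1 w1' \<oplus>\<^bsub>R\<^esub> e2 w2' \<in> S i)"
    if "w1 < m1" "w2 < m2" "w1' < m1" "w2' < m2" for w1 w2 w1' w2'
    using assms(6) that unfolding feasible_expanded_function_def by blast
  have set_Z: "set_pmf (common_randomness R \<gamma>) = carrier R \<times> set_pmf \<gamma>"
    by (simp add: common_randomness_def set_pmf_of_set[OF carrier_not_empty fin])
  have correct: "correct_code m1 m2 f (common_randomness R \<gamma>) (alice R e1) (bob R e2)"
  proof (rule correct_codeI)
    fix w1 w2 w1' w2' zg zg'
    assume w: "w1 < m1" "w2 < m2" "w1' < m1" "w2' < m2"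
      and zg: "zg \<in> set_pmf (common_randomness R \<gamma>)" "zg' \<in> set_pmf (common_randomness R \<gamma>)"
      and eq: "alice R e1 w1 zg = alice R e1 w1' zg'" "bob R e2 w2 zg = bob R e2 w2' zg'"
    \<comment> \<open>Adding the codewords cancels the mask \<open>z\<close>.\<close>
    have sum_eq: "alice R e1 v1 (z, g) \<oplus>\<^bsub>R\<^esub> bob R e2 v2 (z, g) = g \<otimes>\<^bsub>R\<^esub> (e1 v1 \<oplus>\<^bsub>R\<^esub> e2 v2)"
      if "v1 < m1" "v2 < m2" "z \<in> carrier R" "g \<in> set_pmf \<gamma>" for v1 v2 z g
    proof -
      have "e1 v1 \<in> carrier R" "e2 v2 \<in> carrier R" "g \<in> carrier R"
        using that e1 e2 \<gamma> by auto
      with that(3) show ?thesis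
        unfolding alice_def bob_def prod.case by algebra
    qed
    obtain z g z' g' where zg_eq: "zg = (z, g)" "zg' = (z', g')"
      by (cases zg, cases zg')
    have mem: "z \<in> carrier R" "z' \<in> carrier R" "g \<in> set_pmf \<gamma>" "g' \<in> set_pmf \<gamma>"
      using zg by (auto simp: zg_eq set_Z)
    have in_S: "\<exists>i<k. x \<in> S i" if "x \<in> carrier R" for x
      using assms(4) that unfolding confusable_sets_def by blast
    obtain i where i: "i < k" "e1 w1 \<oplus>\<^bsub>R\<^esub> e2 w2 \<in> S i"
      using in_S[of "e1 w1 \<oplus>\<^bsub>R\<^esub> e2 w2"] w e1 e2 by auto
    obtain j where j: "j < k" "e1 w1' \<oplus>\<^bsub>R\<^esub> e2 w2' \<in> S j"
      using in_S[of "e1 w1' \<oplus>\<^bsub>R\<^esub> e2 w2'"] w e1 e2 by auto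
    \<comment> \<open>Equal codeword pairs have equal sums, even when \<open>g\<close> and
      \<open>g'\<close> differ; the common value lies in both \<open>S i\<close> and
      \<open>S j\<close>, and disjointness forces \<open>i = j\<close>.\<close>
    have "g \<otimes>\<^bsub>R\<^esub> (e1 w1 \<oplus>\<^bsub>R\<^esub> e2 w2) = g' \<otimes>\<^bsub>R\<^esub> (e1 w1' \<oplus>\<^bsub>R\<^esub> e2 w2')"
      using sum_eq[of w1 w2 z g] sum_eq[of w1' w2' z' g'] w mem eq by (simp add: zg_eq)
    then have "g \<otimes>\<^bsub>R\<^esub> (e1 w1 \<oplus>\<^bsub>R\<^esub> e2 w2) \<in> S i \<inter> S j"
      using S_closed[OF i mem(3)] S_closed[OF j mem(4)] by simp
    then have "i = j"
      using assms(4) i(1) j(1) unfolding confusable_sets_def disjoint_family_on_def by blast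
    then show "f w1 w2 = f w1' w2'"
      using f_iff[OF w] i j by blast
  qed
  have secure: "secure_code m1 m2 f (common_randomness R \<gamma>) (alice R e1) (bob R e2)"
  proof (rule secure_code_if_distributions_agree)
    show "finite (set_pmf (common_randomness R \<gamma>))"
      using fin \<gamma>_fin by (simp add: set_Z)
    fix w1 w2 w1' w2'
    assume w: "w1 < m1" "w2 < m2" "w1' < m1" "w2' < m2" and "f w1 w2 = f w1' w2'"
    then obtain i where i: "i < k" "e1 w1 \<oplus>\<^bsub>R\<^esub> e2 w2 \<in> S i" "e1 w1' \<oplus>\<^bsub>R\<^esub> e2 w2' \<in> S i"
      using f_iff[OF w] by blast
    \<comment> \<open>By \<open>S_law\<close> the sum \<open>t\<close> is uniform on
      \<open>S i\<close> whichever element of \<open>S i\<close> the expanded inputs add up to, so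
      the right-hand side is the same for both input pairs.\<close>
    have law: "map_pmf (\<lambda>zg. (alice R e1 v1 zg, bob R e2 v2 zg)) (common_randomness R \<gamma>) =
        map_pmf (\<lambda>(t, u). (u, t \<ominus>\<^bsub>R\<^esub> u)) (pair_pmf (pmf_of_set (S i)) (pmf_of_set (carrier R)))"
      if "v1 < m1" "v2 < m2" "e1 v1 \<oplus>\<^bsub>R\<^esub> e2 v2 \<in> S i" for v1 v2
      using code_distribution[OF fin \<gamma> e1[OF that(1)] e2[OF that(2)]] S_law[OF i(1) that(3)]
      by (simp add: alice_def bob_def case_prod_beta')
    show "map_pmf (\<lambda>z. (alice R e1 w1 z, bob R e2 w2 z)) (common_randomness R \<gamma>) =
        map_pmf (\<lambda>z. (alice R e1 w1' z, bob R e2 w2' z)) (common_randomness R \<gamma>)"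
      using law w i by simp
  qed
  have "alice R e1 w1 zg \<in> carrier R"
    if "w1 < m1" "zg \<in> set_pmf (common_randomness R \<gamma>)" for w1 zg
    using that e1[of w1] \<gamma> by (cases zg) (auto simp: set_Z alice_def)
  moreover have "bob R e2 w2 zg \<in> carrier R"
    if "w2 < m2" "zg \<in> set_pmf (common_randomness R \<gamma>)" for w2 zg
    using that e2[of w2] \<gamma> by (cases zg) (auto simp: set_Z bob_def)
  ultimately show ?thesis
    using correct secure by blast
qed

end
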